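(* Let $L:\mathbb{R}^n\to\mathbb{R}$ be twice continuously differentiable, $\beta$-strongly convex for some $\beta>0$, and $K$-smooth (that is, $\nabla L$ is $K$-Lipschitz). Let $\tau_{min},\tau_{max}$ satisfy $0<\tau_{min}\le\tau_{max}<\frac{\beta^2}{3K^3}$. Let $\mathcal{H}=(C,f,D,G)$ be the hybrid system with state $\xi=(z_1,z_2,\tau)$ described in the context. Then there exists a nontrivial solution to $\mathcal{H}$ from every initial point in $C\cup D$. Additionally, every maximal solution $\phi$ to $\mathcal{H}$ is complete and not Zeno.
   Context: Hybrid system. Let $\mathcal{X}=\mathbb{R}^n\times\mathbb{R}^n\times[0,\tau_{max}]$ and $\xi=(z_1,z_2,\tau)\in\mathcal{X}$. The hybrid system $\mathcal{H}=(C,f,D,G)$ is $$\dot\xi=f(\xi):=(-\nabla L(z_2),\,0,\,-1)\ \text{ for }\xi\in C:=\mathcal{X},\qquad \xi^+\in G(\xi):=\{z_1\}\times\{z_1\}\times[\tau_{min},\tau_{max}]\ \text{ for }\xi\in D:=\mathbb{R}^n\times\mathbb{R}^n\times\{0\}.$$ Solutions. A hybrid time domain is a set $E\subset\mathbb{R}_{\ge0}\times\mathbb{N}$ such that for every $(T,J)\in E$, $E\cap([0,T]\times\{0,\dots,J\})=\bigcup_{j=0}^{J}[t_j,t_{j+1}]\times\{j\}$ for some $0=t_0\le t_1\le\dots\le t_{J+1}=T$. A solution $\phi=(\phi_{z_1},\phi_{z_2},\phi_\tau)$ to $\mathcal{H}$ is a function on a (nonempty) hybrid time domain $\operatorname{dom}\phi$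 with $\phi(0,0)\in C\cup D$ such that, writing $I^j=\{t:(t,j)\in\operatorname{dom}\phi\}$: for each $j$, $t\mapsto\phi(t,j)$ is locally absolutely continuous on $I^j$; if $I^j$ has nonempty interior, then $\phi(t,j)\in C$ for all $t$ in the interior of $I^j$ and $\frac{d}{dt}\phi(t,j)=f(\phi(t,j))$ for almost all $t\in I^j$; and whenever $(t,j),(t,j+1)\in\operatorname{dom}\phi$, $\phi(t,j)\in D$ and $\phi(t,j+1)\in G(\phi(t,j))$. A solution is from the point $\xi_0$ if $\phi(0,0)=\xi_0$; it is nontrivial if $\operatorname{dom}\phi$ contains at least two points; maximal if it cannot be extended to a solution with a strictly larger domain; complete if $\operatorname{dom}\phi$ is unbounded; Zeno if it is complete and $\sup\{t:(t,j)\in\operatorname{dom}\phi\text{ for some }j\}<\infty$. *)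

theory Defs
  imports "HOL-Analysis.Analysis"
begin

definition gradient :: "('a::real_inner \<Rightarrow> real) \<Rightarrow> 'a \<Rightarrow> 'a" where
  "gradient L x = (THE g. GDERIV L x :> g)"

lemma gradient_eqI:
  assumes "GDERIV L x :> g"
  shows "gradient L x = g"
  unfolding gradient_def
proof (rule the_equality)
  fix h assume "GDERIV L x :> h"
  then have "(\<lambda>v. v \<bullet> h) = (\<lambda>v. v \<bullet> g)"
    using assms has_derivative_unique unfolding gderiv_def by blast
  then show "h = g"
    by (simp only: fun_eq_iff vector_eq_ldot)
qed (rule assms)

definition twice_continuously_differentiable ::
    "('a::real_normed_vector \<Rightarrow> 'b::real_normed_vector) \<Rightarrow> bool" where
  "twice_continuously_differentiable L \<longleftrightarrow>
     (\<exists>(L' :: 'a \<Rightarrow> 'a \<Rightarrow>\<^sub>L 'b) (L'' :: 'a \<Rightarrow> 'a \<Rightarrow>\<^sub>L ('a \<Rightarrow>\<^sub>L 'b)).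
        (\<forall>x. (L has_derivative blinfun_apply (L' x)) (at x)) \<and>
        (\<forall>x. (L' has_derivative blinfun_apply (L'' x)) (at x)) \<and>
        continuous_on UNIV L'')"

definition strongly_convex :: "real \<Rightarrow> ('a::real_normed_vector \<Rightarrow> real) \<Rightarrow> bool" where
  "strongly_convex \<beta> L \<longleftrightarrow>
     (\<forall>x y. \<forall>t\<in>{0..1}.
        L (t *\<^sub>R x + (1 - t) *\<^sub>R y)
          \<le> t * L x + (1 - t) * L y - \<beta> / 2 * t * (1 - t) * (norm (x - y))\<^sup>2)"

text \<open>A division of a subset of \<open>S\<close> is a finite family of non-overlapping compact intervals
  \<open>k = {Inf k..Sup k}\<close> contained in \<open>S\<close>.\<close>

definition absolutely_continuous_on :: "real set \<Rightarrow> (real \<Rightarrow> 'a::real_normed_vector) \<Rightarrow> bool" where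
  "absolutely_continuous_on S g \<longleftrightarrow>
     (\<forall>\<epsilon>>0. \<exists>\<delta>>0. \<forall>d T. d division_of T \<and> T \<subseteq> S \<and> (\<Sum>k\<in>d. Sup k - Inf k) < \<delta> \<longrightarrow>
        (\<Sum>k\<in>d. norm (g (Sup k) - g (Inf k))) < \<epsilon>)"

definition locally_absolutely_continuous_on ::
    "real set \<Rightarrow> (real \<Rightarrow> 'a::real_normed_vector) \<Rightarrow> bool" where
  "locally_absolutely_continuous_on S g \<longleftrightarrow>
     (\<forall>a b. {a..b} \<subseteq> S \<longrightarrow> absolutely_continuous_on {a..b} g)"

definition hybrid_time_domain :: "(real \<times> nat) set \<Rightarrow> bool" where
  "hybrid_time_domain E \<longleftrightarrow>
     E \<subseteq> {0..} \<times> UNIV \<and>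
     (\<forall>(T, J)\<in>E. \<exists>t :: nat \<Rightarrow> real.
        t 0 = 0 \<and> (\<forall>j\<le>J. t j \<le> t (Suc j)) \<and> t (Suc J) = T \<and>
        E \<inter> ({0..T} \<times> {..J}) = (\<Union>j\<le>J. {t j..t (Suc j)} \<times> {j}))"

lemma hybrid_time_domain_origin:
  assumes "hybrid_time_domain E" and "E \<noteq> {}"
  shows "(0, 0) \<in> E"
proof -
  obtain T J where "(T, J) \<in> E"
    using assms(2) by auto
  then obtain t :: "nat \<Rightarrow> real" where t: "t 0 = 0" "\<forall>j\<le>J. t j \<le> t (Suc j)"
      "E \<inter> ({0..T} \<times> {..J}) = (\<Union>j\<le>J. {t j..t (Suc j)} \<times> {j})"
    using assms(1) unfolding hybrid_time_domain_def by (auto dest!: bspec)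
  have "0 \<le> t (Suc 0)"
    using t(2)[rule_format, of 0] t(1) by simp
  then have "(0, 0) \<in> {t 0..t (Suc 0)} \<times> {0::nat}"
    using t(1) by simp
  then have "(0, 0) \<in> (\<Union>j\<le>J. {t j..t (Suc j)} \<times> {j})"
    by (rule UN_I[rotated]) simp
  then show ?thesis
    unfolding t(3)[symmetric] by (rule IntD1)
qed

record 'a hybrid_system =
  flow_set :: "'a set"
  flow_map :: "'a \<Rightarrow> 'a"
  jump_set :: "'a set"
  jump_map :: "'a \<Rightarrow> 'a set"

text \<open>A solution is a partial function on hybrid time, so that its hybrid time domain is
  its \<open>dom\<close>, and extension of solutions is \<open>\<subseteq>\<^sub>m\<close>.\<close>

type_synonym 'a hybrid_arc = "real \<times> nat \<rightharpoonup> 'a"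

definition time_slice :: "'a hybrid_arc \<Rightarrow> nat \<Rightarrow> real set" where
  "time_slice \<phi> j = {t. (t, j) \<in> dom \<phi>}"

definition hybrid_solution ::
    "'a::real_normed_vector hybrid_system \<Rightarrow> 'a hybrid_arc \<Rightarrow> bool" where
  "hybrid_solution H \<phi> \<longleftrightarrow>
     dom \<phi> \<noteq> {} \<and> hybrid_time_domain (dom \<phi>) \<and>
     the (\<phi> (0, 0)) \<in> flow_set H \<union> jump_set H \<and>
     (\<forall>j. locally_absolutely_continuous_on (time_slice \<phi> j) (\<lambda>t. the (\<phi> (t, j)))) \<and>
     (\<forall>j. interior (time_slice \<phi> j) \<noteq> {} \<longrightarrow>
        (\<forall>t\<in>interior (time_slice \<phi> j). the (\<phi> (t, j)) \<in> flow_set H) \<and>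
        (AE t in lebesgue. t \<in> time_slice \<phi> j \<longrightarrow>
           ((\<lambda>s. the (\<phi> (s, j))) has_vector_derivative flow_map H (the (\<phi> (t, j))))
             (at t within time_slice \<phi> j))) \<and>
     (\<forall>t j. (t, j) \<in> dom \<phi> \<and> (t, Suc j) \<in> dom \<phi> \<longrightarrow>
        the (\<phi> (t, j)) \<in> jump_set H \<and> the (\<phi> (t, Suc j)) \<in> jump_map H (the (\<phi> (t, j))))"

definition solution_from ::
    "'a::real_normed_vector hybrid_system \<Rightarrow> 'a \<Rightarrow> 'a hybrid_arc \<Rightarrow> bool" where
  "solution_from H \<xi>\<^sub>0 \<phi> \<longleftrightarrow> hybrid_solution H \<phi> \<and> \<phi> (0, 0) = Some \<xi>\<^sub>0"

definition nontrivial :: "'a hybrid_arc \<Rightarrow> bool" where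
  "nontrivial \<phi> \<longleftrightarrow> (\<exists>p\<in>dom \<phi>. \<exists>q\<in>dom \<phi>. p \<noteq> q)"

definition maximal_solution ::
    "'a::real_normed_vector hybrid_system \<Rightarrow> 'a hybrid_arc \<Rightarrow> bool" where
  "maximal_solution H \<phi> \<longleftrightarrow>
     hybrid_solution H \<phi> \<and>
     \<not> (\<exists>\<psi>. hybrid_solution H \<psi> \<and> \<phi> \<subseteq>\<^sub>m \<psi> \<and> dom \<phi> \<subset> dom \<psi>)"

definition complete_arc :: "'a hybrid_arc \<Rightarrow> bool" where
  "complete_arc \<phi> \<longleftrightarrow> \<not> bounded ((\<lambda>(t, j). (t, real j)) ` dom \<phi>)"

definition zeno :: "'a hybrid_arc \<Rightarrow> bool" where
  "zeno \<phi> \<longleftrightarrow> complete_arc \<phi> \<and> bdd_above (fst ` dom \<phi>)"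

definition sampled_gradient_system ::
    "(real ^ 'n \<Rightarrow> real) \<Rightarrow> real \<Rightarrow> real \<Rightarrow> ((real ^ 'n) \<times> (real ^ 'n) \<times> real) hybrid_system" where
  "sampled_gradient_system L \<tau>min \<tau>max =
     \<lparr> flow_set = UNIV \<times> UNIV \<times> {0..\<tau>max},
       flow_map = (\<lambda>(z1, z2, \<tau>). (- gradient L z2, 0, - 1)),
       jump_set = UNIV \<times> UNIV \<times> {0},
       jump_map = (\<lambda>(z1, z2, \<tau>). {z1} \<times> {z1} \<times> {\<tau>min..\<tau>max}) \<rparr>"

end

theory Submission
  imports Defs
begin

text \<open>
  The component \<open>z2\<close> is constant along flows, so every solution is affine in \<open>t\<close> on each time
  slice, and its timer decreases with slope \<open>-1\<close> from the value it has at the start of the slice.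
  A solution whose last nonempty slice has index \<open>J\<close> extends by flowing until the timer
  reaches \<open>0\<close> and then jumping. Applied to the one-point solution at the initial state this gives
  existence; it also shows that all slices of a maximal solution are nonempty. Slice \<open>j\<close> of a
  maximal solution lasts exactly as long as its initial timer value, which is at least \<open>\<tau>min\<close> for
  \<open>j \<ge> 1\<close>, so slice \<open>j + 1\<close> starts no earlier than \<open>j * \<tau>min\<close>.
\<close>

subsection \<open>Absolutely continuous functions\<close>

text \<open>The gauge puts tags in the exceptional null set \<open>N\<close> inside an open set of measure less than
  \<open>\<delta>\<close>; absolute continuity bounds the contribution of these tags, differentiability that of the
  others.\<close>

lemma absolutely_continuous_has_integral:
  fixes g :: "real \<Rightarrow> 'a::banach"
  assumes "a \<le> b" and ac: "absolutely_continuous_on {a..b} g"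
    and "AE t in lebesgue. t \<in> {a..b} \<longrightarrow>
      (g has_vector_derivative g' t) (at t within {a..b})"
  shows "(g' has_integral g b - g a) {a..b}"
proof -
  obtain N where N: "negligible N"
    and deriv: "\<And>t. t \<notin> N \<Longrightarrow> t \<in> {a..b} \<Longrightarrow> (g has_vector_derivative g' t) (at t within {a..b})"
    using AE_E3[OF assms(3)] by (auto simp: negligible_iff_null_sets)
  \<comment> \<open>Replacing the derivative by 0 on \<open>N\<close> leaves only the increment of
    \<open>g\<close> to estimate at a tag in \<open>N\<close>. The change is undone at the end,
    since \<open>N\<close> is negligible.\<close>
  define h where "h t = (if t \<in> N then 0 else g' t)" for t
  have "(h has_integral g b - g a) {a..b}"
    unfolding has_integral_real
  proof (intro allI impI)
    fix \<epsilon> :: real assume "\<epsilon> > 0"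
    \<comment> \<open>The share \<open>e * (b - a)\<close> goes to the tags outside \<open>N\<close>
      and one further \<open>e\<close> to those in \<open>N\<close>; the 1 keeps the denominator
      positive when \<open>a = b\<close>.\<close>
    define e where "e = \<epsilon> / (b - a + 1)"
    have "e > 0" "e * (b - a + 1) = \<epsilon>"
      using \<open>\<epsilon> > 0\<close> \<open>a \<le> b\<close> by (auto simp: e_def)
    then have e: "e * (b - a) + e = \<epsilon>"
      by (simp add: distrib_left)
    obtain \<delta> where "\<delta> > 0"
      and \<delta>: "\<And>d T. d division_of T \<Longrightarrow> T \<subseteq> {a..b} \<Longrightarrow> (\<Sum>k\<in>d. Sup k - Inf k) < \<delta>
        \<Longrightarrow> (\<Sum>k\<in>d. norm (g (Sup k) - g (Inf k))) < e"
      using ac \<open>e > 0\<close> unfolding absolutely_continuous_on_def by meson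
    obtain U where U: "open U" "N \<subseteq> U" "U - N \<in> lmeasurable" "emeasure lebesgue (U - N) < ennreal \<delta>"
      using sets_lebesgue_outer_open[OF negligible_imp_sets[OF N] \<open>\<delta> > 0\<close>] .
    have "(U - N) \<union> N \<in> lmeasurable"
      using U(3) negligible_imp_measurable[OF N] by (rule fmeasurable.Un)
    moreover have "(U - N) \<union> N = U"
      using U(2) by blast
    ultimately have U_meas: "U \<in> lmeasurable"
      by simp
    have "measure lebesgue U = measure lebesgue (U - N)"
      using N U_meas by (metis fmeasurableD measure_Diff_null_set negligible_iff_null_sets)
    also have "\<dots> < \<delta>"
      using U(3,4) \<open>\<delta> > 0\<close> by (simp add: emeasure_eq_measure2 ennreal_less_iff)
    finally have U_small: "measure lebesgue U < \<delta>" .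
    have "\<exists>d>0. (x \<in> N \<longrightarrow> ball x d \<subseteq> U) \<and> (x \<notin> N \<longrightarrow> x \<in> {a..b} \<longrightarrow>
        (\<forall>y\<in>{a..b}. norm (y - x) < d \<longrightarrow> norm (g y - g x - (y - x) *\<^sub>R g' x) \<le> e * norm (y - x)))" for x
    proof (cases "x \<in> N")
      case True
      then show ?thesis
        using U(1,2) by (meson open_contains_ball subsetD)
    next
      case False
      then show ?thesis
        using deriv[of x] \<open>e > 0\<close> unfolding has_vector_derivative_def has_derivative_within_alt
        by (metis zero_less_one)
    qed
    then obtain d where d: "\<And>x. d x > 0" "\<And>x. x \<in> N \<Longrightarrow> ball x (d x) \<subseteq> U"
      "\<And>x y. x \<notin> N \<Longrightarrow> x \<in> {a..b} \<Longrightarrow> y \<in> {a..b} \<Longrightarrow> norm (y - x) < d x \<Longrightarrow>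
        norm (g y - g x - (y - x) *\<^sub>R g' x) \<le> e * norm (y - x)"
      by metis
    have "norm ((\<Sum>(x, K)\<in>p. measure lborel K *\<^sub>R h x) - (g b - g a)) < \<epsilon>"
      if p: "p tagged_division_of {a..b}" "(\<lambda>x. ball x (d x)) fine p" for p
    proof -
      note tagged = tagged_division_ofD[OF p(1)]
      define q where "q = {(x, K) \<in> p. x \<in> N}"
      have "q \<subseteq> p"
        by (auto simp: q_def)
      have "finite q"
        using \<open>q \<subseteq> p\<close> tagged(1) finite_subset by blast
      have len: "b - a = (\<Sum>(x, K)\<in>p. Sup K - Inf K)"
        using additive_tagged_division_1[of a b p "\<lambda>x. x"] \<open>a \<le> b\<close> p(1) by simp
      have gdiff: "g b - g a = (\<Sum>(x, K)\<in>p. g (Sup K) - g (Inf K))"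
        using additive_tagged_division_1[of a b p g] \<open>a \<le> b\<close> p(1) by simp
      have q_part: "q tagged_partial_division_of {a..b}"
        using tagged_partial_division_subset[OF _ \<open>q \<subseteq> p\<close>] p(1)
        by (simp add: tagged_division_of_def)
      note q_div = partial_division_of_tagged_division[OF q_part]
      \<comment> \<open>Fineness places the interval of a tag in \<open>N\<close> inside the ball
        about that tag, so the lengths over \<open>q\<close> add up to at most the measure of
        \<open>U\<close>.\<close>
      have in_U: "\<Union>(snd ` q) \<subseteq> U"
      proof
        fix y assume "y \<in> \<Union>(snd ` q)"
        then obtain x K where "(x, K) \<in> p" "x \<in> N" "y \<in> K"
          by (auto simp: q_def)
        then show "y \<in> U"
          using d(2) fineD[OF p(2)] by blast
      qed
      have "(\<Sum>K\<in>snd ` q. Sup K - Inf K) = (\<Sum>K\<in>snd ` q. measure lebesgue K)"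
      proof (rule sum.cong[OF refl])
        fix K assume "K \<in> snd ` q"
        then obtain u v where "K = cbox u v" "K \<noteq> {}"
          using division_ofD(3,4)[OF q_div] by metis
        then show "Sup K - Inf K = measure lebesgue K"
          by (auto simp: cbox_interval)
      qed
      also have "\<dots> = measure lebesgue (\<Union>(snd ` q))"
        by (rule content_division[OF q_div])
      also have "\<dots> \<le> measure lebesgue U"
        using in_U lmeasurable_division[OF q_div] U_meas
        by (intro measure_mono_fmeasurable) (auto intro: fmeasurableD)
      finally have "(\<Sum>K\<in>snd ` q. norm (g (Sup K) - g (Inf K))) < e"
        using U_small tagged_partial_division_ofD(3)[OF q_part] by (intro \<delta>[OF q_div]) force+
      also have "(\<Sum>K\<in>snd ` q. norm (g (Sup K) - g (Inf K)))
          = (\<Sum>(x, K)\<in>q. norm (g (Sup K) - g (Inf K)))"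
      proof -
        \<comment> \<open>Absolute continuity sums over intervals, the Riemann sum over tagged
          pairs. The exchange needs a summand that vanishes on degenerate intervals: one-point
          intervals give 0 anyway, and the case distinction fixes the value at the empty
          set.\<close>
        define D where "D K = (if K = {} then 0 else norm (g (Sup K) - g (Inf K)))" for K
        have "(\<Sum>(x, K)\<in>q. D K) = (\<Sum>K\<in>snd ` q. D K)"
          by (rule sum.over_tagged_division_lemma[OF tagged_partial_division_of_Union_self[OF q_part]])
            (simp add: D_def)
        moreover have "D K = norm (g (Sup K) - g (Inf K))" if "K \<in> snd ` q" for K
          using division_ofD(3)[OF q_div that] by (simp add: D_def)
        ultimately show ?thesis
          by (simp add: split_def)
      qed
      finally have bad: "(\<Sum>(x, K)\<in>q. norm (g (Sup K) - g (Inf K))) < e" .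
      have "norm ((\<Sum>(x, K)\<in>p. measure lborel K *\<^sub>R h x) - (g b - g a))
          = norm (\<Sum>(x, K)\<in>p. measure lborel K *\<^sub>R h x - (g (Sup K) - g (Inf K)))"
        unfolding gdiff by (simp add: split_def sum_subtractf)
      also have "\<dots> \<le> (\<Sum>(x, K)\<in>p. e * (Sup K - Inf K)
          + (if x \<in> N then norm (g (Sup K) - g (Inf K)) else 0))"
      proof (rule sum_norm_le, clarify)
        fix x K assume xK: "(x, K) \<in> p"
        then obtain u v where K: "K = {u..v}" "x \<in> K" "K \<subseteq> {a..b}"
          using tagged(2-4) by (metis cbox_interval)
        have "u \<le> v" "u \<le> x" "x \<le> v" "u \<in> {a..b}" "v \<in> {a..b}" "x \<in> {a..b}"
          using K by auto
        have near: "norm (u - x) < d x" "norm (v - x) < d x"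
          using fineD[OF p(2) xK] \<open>u \<le> v\<close> by (auto simp: K(1) subset_iff dist_real_def)
        show "norm (measure lborel K *\<^sub>R h x - (g (Sup K) - g (Inf K)))
            \<le> e * (Sup K - Inf K) + (if x \<in> N then norm (g (Sup K) - g (Inf K)) else 0)"
        proof (cases "x \<in> N")
          case True
          then show ?thesis
            using \<open>u \<le> v\<close> \<open>e > 0\<close> by (simp add: h_def K(1) norm_minus_commute)
        next
          case False
          \<comment> \<open>Both endpoints are compared with the tag \<open>x\<close>; because
            \<open>x\<close> lies between them, the two error bounds add up to \<open>e\<close>
            times the length of the interval.\<close>
          have "norm (measure lborel K *\<^sub>R h x - (g (Sup K) - g (Inf K)))
              = norm ((g u - g x - (u - x) *\<^sub>R g' x) - (g v - g x - (v - x) *\<^sub>R g' x))"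
            using \<open>u \<le> v\<close> False by (simp add: h_def K(1) algebra_simps)
          also have "\<dots> \<le> e * norm (u - x) + e * norm (v - x)"
            by (intro order_trans[OF norm_triangle_ineq4] add_mono d(3))
              (use False near \<open>u \<in> {a..b}\<close> \<open>v \<in> {a..b}\<close> \<open>x \<in> {a..b}\<close> in auto)
          also have "\<dots> = e * (Sup K - Inf K)"
            using \<open>u \<le> x\<close> \<open>x \<le> v\<close> by (simp add: K(1) algebra_simps)
          finally show ?thesis
            using False by simp
        qed
      qed
      also have "\<dots> = e * (b - a) + (\<Sum>(x, K)\<in>q. norm (g (Sup K) - g (Inf K)))"
      proof -
        have "(\<Sum>(x, K)\<in>p. if x \<in> N then norm (g (Sup K) - g (Inf K)) else 0)
            = (\<Sum>(x, K)\<in>q. norm (g (Sup K) - g (Inf K)))"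
          by (rule sum.mono_neutral_cong_right[OF tagged(1) \<open>q \<subseteq> p\<close>]) (auto simp: q_def split: if_splits)
        then show ?thesis
          unfolding len by (simp add: split_def sum.distrib sum_distrib_left)
      qed
      also have "\<dots> < \<epsilon>"
        using bad e by linarith
      finally show ?thesis .
    qed
    moreover have "gauge (\<lambda>x. ball x (d x))"
      using d(1) by (rule gauge_ball_dependent[rule_format])
    ultimately show "\<exists>\<gamma>. gauge \<gamma> \<and> (\<forall>\<D>. \<D> tagged_division_of {a..b} \<and> \<gamma> fine \<D> \<longrightarrow>
        norm ((\<Sum>(x, K)\<in>\<D>. measure lborel K *\<^sub>R h x) - (g b - g a)) < \<epsilon>)"
      by blast
  qed
  then show ?thesis
    by (rule has_integral_spike[OF N, rotated]) (auto simp: h_def)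
qed

lemma absolutely_continuous_on_subset:
  "absolutely_continuous_on S g \<Longrightarrow> T \<subseteq> S \<Longrightarrow> absolutely_continuous_on T g"
  unfolding absolutely_continuous_on_def by (meson subset_trans)

text \<open>Such a function is Lipschitz on \<open>S\<close>. Values outside \<open>S\<close> stay
  arbitrary, as they are for an arc outside its domain; slope 0 covers one-point slices.\<close>

lemma absolutely_continuous_on_affine:
  fixes g :: "real \<Rightarrow> 'a::real_normed_vector"
  assumes "\<And>t. t \<in> S \<Longrightarrow> g t = c + (t - a) *\<^sub>R v"
  shows "absolutely_continuous_on S g"
  unfolding absolutely_continuous_on_def
proof (intro allI impI)
  fix \<epsilon> :: real assume "\<epsilon> > 0"
  show "\<exists>\<delta>>0. \<forall>d T. d division_of T \<and> T \<subseteq> S \<and> (\<Sum>k\<in>d. Sup k - Inf k) < \<delta> \<longrightarrow>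
      (\<Sum>k\<in>d. norm (g (Sup k) - g (Inf k))) < \<epsilon>"
  proof (intro exI conjI allI impI; (elim conjE)?)
    \<comment> \<open>The constant \<open>norm v + 1\<close> bounds the slope and is positive even
      for \<open>v = 0\<close>.\<close>
    show "\<epsilon> / (norm v + 1) > 0"
      using \<open>\<epsilon> > 0\<close> by (simp add: add_nonneg_pos)
    fix d T assume d: "d division_of T" "T \<subseteq> S" "(\<Sum>k\<in>d. Sup k - Inf k) < \<epsilon> / (norm v + 1)"
    have "norm (g (Sup k) - g (Inf k)) \<le> (norm v + 1) * (Sup k - Inf k)" if kd: "k \<in> d" for k
    proof -
      obtain u w where k: "k = {u..w}" "u \<le> w"
        using division_ofD(3,4)[OF d(1) kd] by (metis atLeastatMost_empty_iff cbox_interval)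
      have "k \<subseteq> S"
        using division_ofD(2)[OF d(1) kd] d(2) by blast
      then have "u \<in> S" "w \<in> S"
        using k by auto
      then have "g w - g u = (w - u) *\<^sub>R v"
        by (simp add: assms algebra_simps)
      then show ?thesis
        using k(2) by (simp add: k(1) distrib_right distrib_left mult.commute)
    qed
    then have "(\<Sum>k\<in>d. norm (g (Sup k) - g (Inf k))) \<le> (norm v + 1) * (\<Sum>k\<in>d. Sup k - Inf k)"
      unfolding sum_distrib_left by (rule sum_mono)
    also have "\<dots> < \<epsilon>"
      using d(3) by (simp add: pos_less_divide_eq add_nonneg_pos mult.commute)
    finally show "(\<Sum>k\<in>d. norm (g (Sup k) - g (Inf k))) < \<epsilon>" .
  qed
qed

subsection \<open>Hybrid time domains\<close>

text \<open>In the decomposition belonging to the later point \<open>(s, j)\<close>, the last piece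
  ends at \<open>s\<close> and contains \<open>r\<close>, hence everything between.\<close>

lemma hybrid_time_domain_interval:
  assumes "hybrid_time_domain E" "(r, j) \<in> E" "(s, j) \<in> E" "r \<le> t" "t \<le> s"
  shows "(t, j) \<in> E"
proof -
  obtain \<sigma> :: "nat \<Rightarrow> real" where \<sigma>: "\<sigma> (Suc j) = s"
    "E \<inter> ({0..s} \<times> {..j}) = (\<Union>i\<le>j. {\<sigma> i..\<sigma> (Suc i)} \<times> {i})"
    using assms(1,3) unfolding hybrid_time_domain_def by (auto dest!: bspec)
  have "(r, j) \<in> E \<inter> ({0..s} \<times> {..j})"
    using assms unfolding hybrid_time_domain_def by auto
  then have "(t, j) \<in> (\<Union>i\<le>j. {\<sigma> i..\<sigma> (Suc i)} \<times> {i})"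
    unfolding \<sigma>(2) using assms \<sigma>(1) by auto
  then show ?thesis
    unfolding \<sigma>(2)[symmetric] by blast
qed

text \<open>The witness is the breakpoint \<open>\<sigma> j\<close> of a decomposition that reaches
  slice \<open>j\<close>. It begins piece \<open>j\<close> and ends piece \<open>j - 1\<close>, so
  it belongs to both slices.\<close>

lemma hybrid_time_domain_start:
  assumes "hybrid_time_domain E" "(s, j) \<in> E"
  obtains a where "(a, j) \<in> E" "\<And>t. (t, j) \<in> E \<Longrightarrow> a \<le> t" "j = 0 \<Longrightarrow> a = 0"
    "\<And>i. j = Suc i \<Longrightarrow> (a, i) \<in> E"
proof -
  obtain \<sigma> :: "nat \<Rightarrow> real" where \<sigma>: "\<sigma> 0 = 0" "\<And>i. i \<le> j \<Longrightarrow> \<sigma> i \<le> \<sigma> (Suc i)" "\<sigma> (Suc j) = s"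
    "E \<inter> ({0..s} \<times> {..j}) = (\<Union>i\<le>j. {\<sigma> i..\<sigma> (Suc i)} \<times> {i})"
    using assms unfolding hybrid_time_domain_def by (auto dest!: bspec)
  have mem: "(t, i) \<in> E" if "i \<le> j" "\<sigma> i \<le> t" "t \<le> \<sigma> (Suc i)" for t i
  proof -
    have "(t, i) \<in> (\<Union>i\<le>j. {\<sigma> i..\<sigma> (Suc i)} \<times> {i})"
      using that by auto
    then show ?thesis
      unfolding \<sigma>(4)[symmetric] by blast
  qed
  show thesis
  proof (rule that)
    show "(\<sigma> j, j) \<in> E"
      using mem \<sigma>(2) by auto
    show "\<sigma> j \<le> t" if "(t, j) \<in> E" for t
    proof (cases "t \<le> s")
      case True
      then have "(t, j) \<in> E \<inter> ({0..s} \<times> {..j})"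
        using that assms(1) unfolding hybrid_time_domain_def by auto
      then show ?thesis
        unfolding \<sigma>(4) by auto
    next
      case False
      then show ?thesis
        using \<sigma>(2)[of j] \<sigma>(3) by simp
    qed
    show "j = 0 \<Longrightarrow> \<sigma> j = 0"
      using \<sigma>(1) by simp
    show "(\<sigma> j, i) \<in> E" if "j = Suc i" for i
      using that mem[of i "\<sigma> j"] \<sigma>(2)[of i] by simp
  qed
qed

lemma hybrid_time_domainI:
  assumes "m 0 = 0" and "\<And>j. m j \<le> m (Suc j)"
    and E: "E = {(t, j). j \<le> N \<and> m j \<le> t \<and> t \<le> m (Suc j)}"
  shows "hybrid_time_domain E"
proof -
  have "incseq m"
    using assms(2) by (rule incseq_SucI)
  then have m_nonneg: "0 \<le> m j" for j
    using assms(1) incseqD[of m 0 j] by simp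
  have "\<exists>\<sigma>. \<sigma> 0 = 0 \<and> (\<forall>j\<le>J. \<sigma> j \<le> \<sigma> (Suc j)) \<and> \<sigma> (Suc J) = T \<and>
      E \<inter> ({0..T} \<times> {..J}) = (\<Union>j\<le>J. {\<sigma> j..\<sigma> (Suc j)} \<times> {j})"
    if TJ: "(T, J) \<in> E" for T J
  proof (intro exI conjI)
    \<comment> \<open>The breakpoints for \<open>(T, J)\<close> are those of \<open>m\<close> up to
      index \<open>J\<close>, then \<open>T\<close>, which may cut piece \<open>J\<close>
      short.\<close>
    define \<sigma> where "\<sigma> j = (if j \<le> J then m j else T)" for j
    show "\<sigma> 0 = 0" "\<forall>j\<le>J. \<sigma> j \<le> \<sigma> (Suc j)" "\<sigma> (Suc J) = T"
      using TJ assms(1,2) by (auto simp: \<sigma>_def E not_less_eq_eq dest: le_antisym)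
    have slice: "(t, j) \<in> E \<inter> ({0..T} \<times> {..J}) \<longleftrightarrow> j \<le> J \<and> \<sigma> j \<le> t \<and> t \<le> \<sigma> (Suc j)" for t j
    proof (cases "j < J")
      case True
      then have "m (Suc j) \<le> m J"
        using incseqD[OF \<open>incseq m\<close>, of "Suc j" J] by simp
      then show ?thesis
        using True TJ m_nonneg[of j] by (auto simp: \<sigma>_def E)
    next
      case False
      then show ?thesis
        using TJ m_nonneg[of j] by (cases "j = J") (auto simp: \<sigma>_def E)
    qed
    show "E \<inter> ({0..T} \<times> {..J}) = (\<Union>j\<le>J. {\<sigma> j..\<sigma> (Suc j)} \<times> {j})"
    proof (rule set_eqI)
      fix p :: "real \<times> nat"
      show "p \<in> E \<inter> ({0..T} \<times> {..J}) \<longleftrightarrow> p \<in> (\<Union>j\<le>J. {\<sigma> j..\<sigma> (Suc j)} \<times> {j})"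
        using slice[of "fst p" "snd p"] by (cases p) auto
    qed
  qed
  moreover have "E \<subseteq> {0..} \<times> UNIV"
    using m_nonneg by (auto simp: E intro: order_trans)
  ultimately show ?thesis
    unfolding hybrid_time_domain_def by auto
qed

text \<open>The infimum makes this total in \<open>j\<close>; it is attained on a nonempty slice and
  carries no information on an empty one.\<close>

definition slice_start :: "'a hybrid_arc \<Rightarrow> nat \<Rightarrow> real" where
  "slice_start \<phi> j = Inf (time_slice \<phi> j)"

lemma
  assumes "hybrid_time_domain (dom \<phi>)" "t \<in> time_slice \<phi> j"
  shows slice_start_in: "slice_start \<phi> j \<in> time_slice \<phi> j"
    and slice_start_le: "slice_start \<phi> j \<le> t"
    and slice_start_0: "j = 0 \<Longrightarrow> slice_start \<phi> j = 0"
    and slice_start_Suc: "j = Suc i \<Longrightarrow> slice_start \<phi> j \<in> time_slice \<phi> i"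
proof -
  obtain a where a: "a \<in> time_slice \<phi> j" "\<And>s. s \<in> time_slice \<phi> j \<Longrightarrow> a \<le> s" "j = 0 \<Longrightarrow> a = 0"
    "\<And>i. j = Suc i \<Longrightarrow> a \<in> time_slice \<phi> i"
    using hybrid_time_domain_start[OF assms(1), of t j] assms(2) unfolding time_slice_def
    by (metis mem_Collect_eq)
  have "slice_start \<phi> j = a"
    unfolding slice_start_def using a(1,2) by (rule cInf_eq_minimum)
  then show "slice_start \<phi> j \<in> time_slice \<phi> j" "slice_start \<phi> j \<le> t"
    "j = 0 \<Longrightarrow> slice_start \<phi> j = 0" "j = Suc i \<Longrightarrow> slice_start \<phi> j \<in> time_slice \<phi> i"
    using a assms(2) by auto
qed

lemma time_slice_interval:
  assumes "hybrid_time_domain (dom \<phi>)" "r \<in> time_slice \<phi> j" "s \<in> time_slice \<phi> j" "r \<le> t" "t \<le> s"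
  shows "t \<in> time_slice \<phi> j"
  using hybrid_time_domain_interval[OF assms(1) _ _ assms(4,5), of j] assms(2,3)
  by (simp add: time_slice_def)

lemma time_slice_nonempty_le:
  assumes "hybrid_time_domain (dom \<phi>)" "time_slice \<phi> j \<noteq> {}" "i \<le> j"
  shows "time_slice \<phi> i \<noteq> {}"
  using assms(3,2)
proof (induction rule: inc_induct)
  case (step i)
  then show ?case
    using slice_start_Suc[OF assms(1) _ refl, of _ i] by blast
qed

subsection \<open>Solutions of the sampled gradient system\<close>

context
  fixes L :: "real ^ 'n \<Rightarrow> real" and \<tau>min \<tau>max :: real
    and H :: "((real ^ 'n) \<times> (real ^ 'n) \<times> real) hybrid_system"
  assumes \<tau>: "0 < \<tau>min" "\<tau>min \<le> \<tau>max"
  defines "H \<equiv> sampled_gradient_system L \<tau>min \<tau>max"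
begin

section \<open>The data of the system and the flow along one slice\<close>

lemma sampled_gradient_system_sel:
  shows flow_set_H: "flow_set H = {\<xi>. snd (snd \<xi>) \<in> {0..\<tau>max}}"
    and jump_set_H: "jump_set H = {\<xi>. snd (snd \<xi>) = 0}"
    and flow_map_H: "flow_map H \<xi> = (- gradient L (fst (snd \<xi>)), 0, - 1)"
    and jump_map_H: "jump_map H \<xi> = {fst \<xi>} \<times> {fst \<xi>} \<times> {\<tau>min..\<tau>max}"
  by (auto simp: H_def sampled_gradient_system_def split_beta)

lemma flow_set_subset: "flow_set H \<union> jump_set H = flow_set H"
  using \<tau> by (auto simp: flow_set_H jump_set_H)

text \<open>The vector field depends only on \<open>z2\<close>, whose own derivative is 0. A first
  integration shows that \<open>z2\<close> is constant, so the field is constant along the slice; a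
  second one gives the formula.\<close>

lemma flow_affine:
  assumes sol: "hybrid_solution H \<phi>" and r: "r \<in> time_slice \<phi> j" and s: "s \<in> time_slice \<phi> j"
    and "r \<le> s"
  shows "the (\<phi> (s, j)) = the (\<phi> (r, j)) + (s - r) *\<^sub>R flow_map H (the (\<phi> (r, j)))"
\<comment> \<open>When \<open>r = s\<close> the slice may have empty interior, and the differential
  equation then says nothing; the claim is trivial.\<close>
proof (cases "r = s")
  case False
  define w where "w t = the (\<phi> (t, j))" for t
  have htd: "hybrid_time_domain (dom \<phi>)"
    using sol by (simp add: hybrid_solution_def)
  have sub: "{r..s} \<subseteq> time_slice \<phi> j"
    using time_slice_interval[OF htd r s] by auto
  have ac: "absolutely_continuous_on {r..s} w"
    using sol sub unfolding hybrid_solution_def locally_absolutely_continuous_on_def w_def by blast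
  have "{r<..<s} \<subseteq> interior (time_slice \<phi> j)"
    using sub by (intro interior_maximal) (auto simp: subset_iff)
  moreover have "(r + s) / 2 \<in> {r<..<s}"
    using False \<open>r \<le> s\<close> by auto
  ultimately have "interior (time_slice \<phi> j) \<noteq> {}"
    by blast
  then have "AE t in lebesgue. t \<in> time_slice \<phi> j \<longrightarrow>
      (w has_vector_derivative flow_map H (w t)) (at t within time_slice \<phi> j)"
    using sol unfolding hybrid_solution_def w_def by blast
  then have deriv: "AE t in lebesgue. t \<in> {r..s} \<longrightarrow>
      (w has_vector_derivative flow_map H (w t)) (at t within {r..s})"
  proof eventually_elim
    case (elim t)
    then show ?case
      using sub has_vector_derivative_within_subset by blast
  qed
  have int: "((\<lambda>t. flow_map H (w t)) has_integral w t - w r) {r..t}" if "t \<in> {r..s}" for t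
  proof (rule absolutely_continuous_has_integral)
    show "r \<le> t" using that by simp
    show "absolutely_continuous_on {r..t} w"
      using ac by (rule absolutely_continuous_on_subset) (use that in auto)
    show "AE u in lebesgue. u \<in> {r..t} \<longrightarrow>
        (w has_vector_derivative flow_map H (w u)) (at u within {r..t})"
      using deriv
    proof eventually_elim
      case (elim u)
      have "{r..t} \<subseteq> {r..s}"
        using that by auto
      then show ?case
        using elim has_vector_derivative_within_subset by blast
    qed
  qed
  have z2: "fst (snd (w t)) = fst (snd (w r))" if "t \<in> {r..s}" for t
  proof -
    have "bounded_linear (fst \<circ> snd :: (real^'n) \<times> (real^'n) \<times> real \<Rightarrow> real^'n)"
      by (intro bounded_linear_compose[unfolded o_def[symmetric]] bounded_linear_fst bounded_linear_snd)
    from has_integral_linear[OF int[OF that] this]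
    have "((\<lambda>t. 0) has_integral fst (snd (w t)) - fst (snd (w r))) {r..t}"
      by (simp add: o_def flow_map_H)
    then show ?thesis
      using has_integral_0_eq by fastforce
  qed
  have "((\<lambda>t. flow_map H (w r)) has_integral w s - w r) {r..s}"
  proof (rule has_integral_eq[OF _ int[of s]])
    show "flow_map H (w t) = flow_map H (w r)" if "t \<in> {r..s}" for t
      using z2[OF that] by (simp add: flow_map_H)
  qed (use \<open>r \<le> s\<close> in simp)
  moreover have "((\<lambda>t. flow_map H (w r)) has_integral (s - r) *\<^sub>R flow_map H (w r)) {r..s}"
    using has_integral_const_real[of "flow_map H (w r)" r s] \<open>r \<le> s\<close> by simp
  ultimately have "w s - w r = (s - r) *\<^sub>R flow_map H (w r)"
    by (rule has_integral_unique)
  then show ?thesis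
    by (simp add: w_def algebra_simps)
qed simp

section \<open>Timer values and slice lengths\<close>

abbreviation "start_state \<phi> j \<equiv> the (\<phi> (slice_start \<phi> j, j))"

text \<open>The start of slice \<open>j + 1\<close> also lies in slice \<open>j\<close>, so it is a
  jump time: the timer is 0 before the jump and is reset by it.\<close>

lemma start_state_in_jump_map:
  assumes "hybrid_solution H \<phi>" "t \<in> time_slice \<phi> (Suc j)"
  shows "snd (snd (start_state \<phi> (Suc j))) \<in> {\<tau>min..\<tau>max}"
    and "snd (snd (the (\<phi> (slice_start \<phi> (Suc j), j)))) = 0"
proof -
  have htd: "hybrid_time_domain (dom \<phi>)"
    using assms by (simp add: hybrid_solution_def)
  have "(slice_start \<phi> (Suc j), Suc j) \<in> dom \<phi>" "(slice_start \<phi> (Suc j), j) \<in> dom \<phi>"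
    using slice_start_in[OF htd assms(2)] slice_start_Suc[OF htd assms(2) refl]
    unfolding time_slice_def by auto
  then have "the (\<phi> (slice_start \<phi> (Suc j), j)) \<in> jump_set H"
    "start_state \<phi> (Suc j) \<in> jump_map H (the (\<phi> (slice_start \<phi> (Suc j), j)))"
    using assms(1) unfolding hybrid_solution_def by blast+
  then show "snd (snd (start_state \<phi> (Suc j))) \<in> {\<tau>min..\<tau>max}"
    "snd (snd (the (\<phi> (slice_start \<phi> (Suc j), j)))) = 0"
    by (auto simp: jump_set_H jump_map_H)
qed

text \<open>The flow condition constrains states only in the interior of a slice. At the start, the
  initial condition (slice 0) or the reset range (later slices) takes its place.\<close>

lemma start_state_in_flow_set:
  assumes "hybrid_solution H \<phi>" "t \<in> time_slice \<phi> j"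
  shows "start_state \<phi> j \<in> flow_set H"
proof (cases j)
  case 0
  then show ?thesis
    using assms slice_start_0[of \<phi> t j] unfolding hybrid_solution_def flow_set_subset by simp
next
  case (Suc i)
  then show ?thesis
    using start_state_in_jump_map(1)[of \<phi> t i] assms \<tau> by (simp add: flow_set_H)
qed

text \<open>The timer falls at unit rate and is nonnegative in the interior of the slice. As
  \<open>t\<close> may be an endpoint, the bound is shown for all \<open>s < t\<close> and passes to
  \<open>t\<close> by density.\<close>

lemma slice_le:
  assumes sol: "hybrid_solution H \<phi>" and t: "t \<in> time_slice \<phi> j"
  shows "t \<le> slice_start \<phi> j + snd (snd (start_state \<phi> j))"
proof (rule dense_le_bounded)
  define m where "m = slice_start \<phi> j"
  have htd: "hybrid_time_domain (dom \<phi>)"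
    using sol by (simp add: hybrid_solution_def)
  \<comment> \<open>Density needs a bound strictly below \<open>t\<close>, which \<open>m\<close>
    itself is not when \<open>t = m\<close>.\<close>
  show "m - 1 < t"
    using slice_start_le[OF htd t] by (simp add: m_def)
  fix s assume s: "m - 1 < s" "s < t"
  show "s \<le> slice_start \<phi> j + snd (snd (start_state \<phi> j))"
  proof (cases "s \<le> m")
    case True
    then show ?thesis
      using start_state_in_flow_set[OF sol t] by (simp add: m_def flow_set_H)
  next
    case False
    note m_in = slice_start_in[OF htd t, folded m_def]
    have "{m<..<t} \<subseteq> interior (time_slice \<phi> j)"
      using time_slice_interval[OF htd m_in t] by (intro interior_maximal) auto
    then have "s \<in> interior (time_slice \<phi> j)"
      using s False by auto
    then have "the (\<phi> (s, j)) \<in> flow_set H" "s \<in> time_slice \<phi> j"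
      using sol interior_subset unfolding hybrid_solution_def by blast+
    then show ?thesis
      using flow_affine[OF sol m_in, of s] False by (simp add: flow_set_H flow_map_H m_def)
  qed
qed

text \<open>At the jump time the affine timer, start value minus elapsed time, equals 0.\<close>

lemma slice_start_step:
  assumes sol: "hybrid_solution H \<phi>" and t: "t \<in> time_slice \<phi> (Suc j)"
  shows "slice_start \<phi> (Suc j) = slice_start \<phi> j + snd (snd (start_state \<phi> j))"
proof -
  have htd: "hybrid_time_domain (dom \<phi>)"
    using sol by (simp add: hybrid_solution_def)
  note a = slice_start_Suc[OF htd t refl]
  show ?thesis
    using flow_affine[OF sol slice_start_in[OF htd a] a slice_start_le[OF htd a]]
      start_state_in_jump_map(2)[OF sol t]
    by (simp add: flow_map_H)
qed

text \<open>This is not true of arbitrary hybrid time domains: \<open>{0..1} \<times> {0} \<union> {(0, 1)}\<close> is one by the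
  definition. Here the zero timer at a jump prevents any further flow in slice \<open>j\<close>.\<close>

lemma time_slice_eq:
  assumes sol: "hybrid_solution H \<phi>" and t: "t \<in> time_slice \<phi> (Suc j)"
  shows "time_slice \<phi> j = {slice_start \<phi> j..slice_start \<phi> (Suc j)}"
proof -
  have htd: "hybrid_time_domain (dom \<phi>)"
    using sol by (simp add: hybrid_solution_def)
  note a = slice_start_Suc[OF htd t refl]
  show ?thesis
    using slice_start_le[OF htd] slice_le[OF sol] time_slice_interval[OF htd slice_start_in[OF htd a] a]
    unfolding slice_start_step[OF sol t] by auto
qed

section \<open>Extension beyond the last slice\<close>

text \<open>The last slice may be half-open or stop early. In every case its states lie on the full
  affine arc \<open>\<eta>\<close> over \<open>{m..c}\<close>, so replacing it by that arc extends
  \<open>\<phi>\<close>, and a jump at \<open>c\<close> supplies the new slice.\<close>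

lemma hybrid_solution_extend:
  assumes sol: "hybrid_solution H \<phi>" and t: "t \<in> time_slice \<phi> J"
    and last: "time_slice \<phi> (Suc J) = {}"
  obtains \<psi> where "hybrid_solution H \<psi>" "\<phi> \<subseteq>\<^sub>m \<psi>" "time_slice \<psi> (Suc J) \<noteq> {}"
proof -
  have htd: "hybrid_time_domain (dom \<phi>)"
    using sol by (simp add: hybrid_solution_def)
  have le_J: "j \<le> J" if "s \<in> time_slice \<phi> j" for s j
    using time_slice_nonempty_le[OF htd, of j "Suc J"] that last by (cases "j \<le> J") auto
  have nonempty: "time_slice \<phi> j \<noteq> {}" if "j \<le> J" for j
    using time_slice_nonempty_le[OF htd _ that] t by blast
  define m where "m = slice_start \<phi> J"
  define \<xi> where "\<xi> = start_state \<phi> J"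
  \<comment> \<open>The time at which the timer, started at \<open>m\<close>, reaches 0.\<close>
  define c where "c = m + snd (snd \<xi>)"
  define \<eta> where "\<eta> s = \<xi> + (s - m) *\<^sub>R flow_map H \<xi>" for s
  \<comment> \<open>The new slice is the single time \<open>c\<close>; \<open>\<tau>min\<close> is
    one admissible reset value.\<close>
  define \<psi> :: "((real ^ 'n) \<times> (real ^ 'n) \<times> real) hybrid_arc" where
    "\<psi> = (\<lambda>(s, j). if j < J then \<phi> (s, j)
       else if j = J then if m \<le> s \<and> s \<le> c then Some (\<eta> s) else None
       else if j = Suc J \<and> s = c then Some (fst (\<eta> c), fst (\<eta> c), \<tau>min) else None)"
  have \<xi>: "0 \<le> snd (snd \<xi>)" "snd (snd \<xi>) \<le> \<tau>max"
    using start_state_in_flow_set[OF sol t] by (simp_all add: \<xi>_def flow_set_H)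
  then have "m \<le> c"
    by (simp add: c_def)
  have \<eta>_timer: "snd (snd (\<eta> s)) = c - s" for s
    by (simp add: \<eta>_def c_def flow_map_H)
  have \<eta>_flow: "flow_map H (\<eta> s) = flow_map H \<xi>" for s
    by (simp add: \<eta>_def flow_map_H)
  have \<phi>_last: "m \<le> s \<and> s \<le> c \<and> the (\<phi> (s, J)) = \<eta> s" if "s \<in> time_slice \<phi> J" for s
    using slice_start_le[OF htd that] slice_le[OF sol that]
      flow_affine[OF sol slice_start_in[OF htd that] that]
    by (simp add: m_def c_def \<xi>_def \<eta>_def)
  have \<psi>_less: "\<psi> (s, j) = \<phi> (s, j)" if "j < J" for s j
    using that by (simp add: \<psi>_def)
  have \<psi>_J: "\<psi> (s, J) = Some (\<eta> s)" if "s \<in> {m..c}" for s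
    using that by (simp add: \<psi>_def)
  have slice_less: "time_slice \<psi> j = time_slice \<phi> j" if "j < J" for j
    using that by (auto simp: time_slice_def domIff \<psi>_less)
  have slice_J: "time_slice \<psi> J = {m..c}"
    by (auto simp: time_slice_def domIff \<psi>_def simp del: not_None_eq split: if_splits)
  have slice_Suc: "time_slice \<psi> (Suc J) = {c}"
    by (auto simp: time_slice_def domIff \<psi>_def simp del: not_None_eq split: if_splits)
  have slice_greater: "time_slice \<psi> j = {}" if "Suc J < j" for j
    using that by (auto simp: time_slice_def domIff \<psi>_def simp del: not_None_eq split: if_splits)
  have in_dom: "(s, j) \<in> dom \<rho> \<longleftrightarrow> s \<in> time_slice \<rho> j"
    for s j and \<rho> :: "((real ^ 'n) \<times> (real ^ 'n) \<times> real) hybrid_arc"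
    by (simp add: time_slice_def)
  have jump: "the (\<phi> (s, j)) \<in> jump_set H \<and> the (\<phi> (s, Suc j)) \<in> jump_map H (the (\<phi> (s, j)))"
    if "s \<in> time_slice \<phi> j" "s \<in> time_slice \<phi> (Suc j)" for s j
    using sol that unfolding hybrid_solution_def time_slice_def by blast
  have extends: "\<phi> \<subseteq>\<^sub>m \<psi>"
    unfolding map_le_def
  proof clarify
    fix s j x assume x: "\<phi> (s, j) = Some x"
    then have s: "s \<in> time_slice \<phi> j"
      by (auto simp: time_slice_def)
    show "\<phi> (s, j) = \<psi> (s, j)"
    proof (cases "j = J")
      case True
      then show ?thesis
        using \<phi>_last[of s] s \<psi>_J[of s] x by auto
    next
      case False
      then show ?thesis
        using le_J[OF s] \<psi>_less by simp
    qed
  qed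
  have htd_\<psi>: "hybrid_time_domain (dom \<psi>)"
  proof (rule hybrid_time_domainI)
    \<comment> \<open>Being constantly \<open>c\<close> after index \<open>J\<close> makes slice
      \<open>J + 1\<close> the single point \<open>c\<close>.\<close>
    define M where "M j = (if j \<le> J then slice_start \<phi> j else c)" for j
    show "M 0 = 0"
      using slice_start_0[OF htd] nonempty[of 0] by (auto simp: M_def)
    show "M j \<le> M (Suc j)" for j
    proof (cases "j < J")
      case True
      then have "slice_start \<phi> (Suc j) \<in> time_slice \<phi> j"
        using nonempty[of "Suc j"] slice_start_Suc[OF htd _ refl] by auto
      then show ?thesis
        using True slice_start_le[OF htd] by (auto simp: M_def)
    next
      case False
      then show ?thesis
        using \<open>m \<le> c\<close> by (cases "j = J") (auto simp: M_def m_def)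
    qed
    have "s \<in> time_slice \<psi> j \<longleftrightarrow> j \<le> Suc J \<and> M j \<le> s \<and> s \<le> M (Suc j)" for s j
    proof -
      consider "j < J" | "j = J" | "j = Suc J" | "Suc J < j"
        by linarith
      then show ?thesis
      proof cases
        case 1
        then obtain r where "r \<in> time_slice \<phi> (Suc j)"
          using nonempty[of "Suc j"] by auto
        from time_slice_eq[OF sol this] 1 show ?thesis
          by (auto simp: slice_less M_def)
      qed (auto simp: slice_J slice_Suc slice_greater M_def m_def)
    qed
    then show "dom \<psi> = {(s, j). j \<le> Suc J \<and> M j \<le> s \<and> s \<le> M (Suc j)}"
      unfolding set_eq_iff split_paired_All in_dom by simp
  qed
  have dom_\<psi>: "dom \<psi> \<noteq> {}"
    using slice_Suc by (auto simp: time_slice_def)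
  have init_\<psi>: "the (\<psi> (0, 0)) \<in> flow_set H \<union> jump_set H"
  proof -
    have "(0, 0) \<in> dom \<phi>"
      using sol hybrid_time_domain_origin by (simp add: hybrid_solution_def)
    then have "\<psi> (0, 0) = \<phi> (0, 0)"
      using extends by (simp add: map_le_def)
    then show ?thesis
      using sol by (simp add: hybrid_solution_def)
  qed
  have ac_\<psi>: "locally_absolutely_continuous_on (time_slice \<psi> j) (\<lambda>s. the (\<psi> (s, j)))" for j
  proof (cases "j < J")
    case True
    have "locally_absolutely_continuous_on (time_slice \<phi> j) (\<lambda>s. the (\<phi> (s, j)))"
      using sol by (simp add: hybrid_solution_def)
    then show ?thesis
      using True by (simp add: slice_less \<psi>_less)
  next
    case False
    then consider "j = J" | "j = Suc J" | "Suc J < j"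
      by linarith
    \<comment> \<open>Slice \<open>J\<close> has the slope of the flow, the one-point slice
      \<open>J + 1\<close> slope 0, and later slices are empty.\<close>
    then have "\<exists>p v. \<forall>s\<in>time_slice \<psi> j. the (\<psi> (s, j)) = p + (s - m) *\<^sub>R v"
    proof cases
      case 1
      then have "\<forall>s\<in>time_slice \<psi> j. the (\<psi> (s, j)) = \<xi> + (s - m) *\<^sub>R flow_map H \<xi>"
        by (simp add: slice_J \<psi>_J \<eta>_def)
      then show ?thesis
        by blast
    next
      case 2
      then have "\<forall>s\<in>time_slice \<psi> j. the (\<psi> (s, j)) = the (\<psi> (c, j)) + (s - m) *\<^sub>R 0"
        by (simp add: slice_Suc)
      then show ?thesis
        by blast
    qed (simp add: slice_greater)
    then obtain p v where pv: "\<And>s. s \<in> time_slice \<psi> j \<Longrightarrow> the (\<psi> (s, j)) = p + (s - m) *\<^sub>R v"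
      by blast
    show ?thesis
      unfolding locally_absolutely_continuous_on_def
    proof (intro allI impI)
      fix a b assume "{a..b} \<subseteq> time_slice \<psi> j"
      then show "absolutely_continuous_on {a..b} (\<lambda>s. the (\<psi> (s, j)))"
        by (intro absolutely_continuous_on_affine[of _ _ p m v] pv) blast
    qed
  qed
  have flow_\<psi>: "(\<forall>s\<in>interior (time_slice \<psi> j). the (\<psi> (s, j)) \<in> flow_set H) \<and>
      (AE s in lebesgue. s \<in> time_slice \<psi> j \<longrightarrow>
        ((\<lambda>r. the (\<psi> (r, j))) has_vector_derivative flow_map H (the (\<psi> (s, j))))
          (at s within time_slice \<psi> j))"
    if j: "interior (time_slice \<psi> j) \<noteq> {}" for j
  proof -
    consider "j < J" | "j = J" | "j = Suc J" | "Suc J < j"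
      by linarith
    then show ?thesis
    proof cases
      case 1
      then show ?thesis
        using sol j unfolding hybrid_solution_def slice_less[OF 1] \<psi>_less[OF 1] by blast
    next
      case 2
      \<comment> \<open>On \<open>{m..c}\<close> the timer \<open>c - s\<close> runs from its start
        value, at most \<open>\<tau>max\<close>, down to 0.\<close>
      have "the (\<psi> (s, J)) \<in> flow_set H" if "s \<in> {m..c}" for s
        using that \<xi> by (simp add: \<psi>_J flow_set_H \<eta>_timer c_def)
      moreover have "((\<lambda>r. the (\<psi> (r, J))) has_vector_derivative flow_map H (the (\<psi> (s, J))))
          (at s within {m..c})" if s: "s \<in> {m..c}" for s
      proof (rule has_vector_derivative_transform[OF s])
        show "the (\<psi> (r, J)) = \<eta> r" if "r \<in> {m..c}" for r
          using that by (simp add: \<psi>_J)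
        show "(\<eta> has_vector_derivative flow_map H (the (\<psi> (s, J)))) (at s within {m..c})"
          using s unfolding \<eta>_def[abs_def] has_vector_derivative_def
          by (auto simp: \<psi>_J \<eta>_flow intro!: derivative_eq_intros)
      qed
      ultimately show ?thesis
        using interior_subset unfolding 2 slice_J by auto
    next
      case 3
      then show ?thesis
        using j by (simp add: slice_Suc)
    next
      case 4
      then show ?thesis
        using j by (simp add: slice_greater)
    qed
  qed
  have jump_\<psi>: "the (\<psi> (s, j)) \<in> jump_set H \<and> the (\<psi> (s, Suc j)) \<in> jump_map H (the (\<psi> (s, j)))"
    if s: "s \<in> time_slice \<psi> j" "s \<in> time_slice \<psi> (Suc j)" for s j
  proof -
    consider "Suc j < J" | "Suc j = J" | "j = J" | "J < j"
      by linarith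
    then show ?thesis
    proof cases
      case 3
      then have "s = c"
        using s(2) slice_Suc by simp
      have "\<psi> (c, J) = Some (\<eta> c)" "\<psi> (c, Suc J) = Some (fst (\<eta> c), fst (\<eta> c), \<tau>min)"
        using \<open>m \<le> c\<close> by (simp_all add: \<psi>_def)
      then show ?thesis
        unfolding 3 \<open>s = c\<close> using \<tau> by (simp add: jump_set_H jump_map_H \<eta>_timer)
    next
      case 4
      then show ?thesis
        using s(2) slice_greater by simp
    next
      case 1
      then show ?thesis
        using jump[of s j] s by (simp add: slice_less \<psi>_less)
    next
      \<comment> \<open>Lengthening slice \<open>J\<close> creates no new jump from slice
        \<open>J - 1\<close>: that slice ends at \<open>m\<close>, where slice \<open>J\<close>
        begins, so \<open>s = m\<close> is already a jump time of \<open>\<phi>\<close>.\<close>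
      case 2
      have "j < J"
        using 2 by simp
      have m: "m \<in> time_slice \<phi> J"
        using slice_start_in[OF htd t] by (simp add: m_def)
      have "s \<le> m"
        using s(1) time_slice_eq[OF sol, of t j] t unfolding slice_less[OF \<open>j < J\<close>] 2
        by (simp add: m_def)
      then have "s = m"
        using s(2) unfolding 2 slice_J by simp
      then have "s \<in> time_slice \<phi> (Suc j)" "\<psi> (s, Suc j) = \<phi> (s, Suc j)"
        using m bspec[OF extends[unfolded map_le_def], of "(m, J)"] unfolding 2 in_dom by simp_all
      moreover have "\<psi> (s, j) = \<phi> (s, j)" "s \<in> time_slice \<phi> j"
        using s(1) \<open>j < J\<close> by (simp_all add: \<psi>_less slice_less)
      ultimately show ?thesis
        using jump[of s j] by simp
    qed
  qed
  have "hybrid_solution H \<psi>"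
    unfolding hybrid_solution_def in_dom
    by (intro conjI allI impI dom_\<psi> htd_\<psi> init_\<psi> ac_\<psi> flow_\<psi>[THEN conjunct1]
        flow_\<psi>[THEN conjunct2] jump_\<psi>[THEN conjunct1] jump_\<psi>[THEN conjunct2];
        (elim conjE)?; assumption)
  then show thesis
    using that extends slice_Suc by blast
qed

section \<open>Existence of nontrivial solutions\<close>

lemma hybrid_solution_singleton:
  assumes "\<xi> \<in> flow_set H \<union> jump_set H"
  shows "hybrid_solution H [(0, 0) \<mapsto> \<xi>]"
proof -
  let ?\<phi> = "[(0 :: real, 0 :: nat) \<mapsto> \<xi>]"
  \<comment> \<open>Every slice is a point or empty, so its interior is empty and the flow condition
    holds vacuously; no time lies in two slices.\<close>
  have slice: "time_slice ?\<phi> j = (if j = 0 then {0} else {})" for j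
    by (auto simp: time_slice_def)
  have "absolutely_continuous_on {a..b} (\<lambda>t. the (?\<phi> (t, j)))"
    if "{a..b} \<subseteq> time_slice ?\<phi> j" for a b j
    by (rule absolutely_continuous_on_affine[where c = \<xi> and a = 0 and v = 0])
      (use that in \<open>cases j; auto simp: slice\<close>)
  moreover have "hybrid_time_domain (dom ?\<phi>)"
    by (rule hybrid_time_domainI[where m = "\<lambda>_. 0" and N = 0]) auto
  ultimately show ?thesis
    using assms by (simp add: hybrid_solution_def slice locally_absolutely_continuous_on_def)
qed

text \<open>The extension has a point in slice 1 besides \<open>(0, 0)\<close>, even when the
  initial timer is 0 and the jump is immediate.\<close>

lemma nontrivial_solution_exists:
  assumes "\<xi> \<in> flow_set H \<union> jump_set H"
  shows "\<exists>\<phi>. solution_from H \<xi> \<phi> \<and> nontrivial \<phi>"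
proof -
  have "(0 :: real) \<in> time_slice [(0, 0) \<mapsto> \<xi>] 0" "time_slice [(0, 0) \<mapsto> \<xi>] (Suc 0) = {}"
    by (auto simp: time_slice_def)
  from hybrid_solution_extend[OF hybrid_solution_singleton[OF assms] this]
  obtain \<psi> where \<psi>: "hybrid_solution H \<psi>" "[(0, 0) \<mapsto> \<xi>] \<subseteq>\<^sub>m \<psi>" "time_slice \<psi> (Suc 0) \<noteq> {}" .
  have "\<psi> (0, 0) = Some \<xi>"
    using \<psi>(2) by (simp add: map_le_def)
  moreover obtain t where "(t, Suc 0) \<in> dom \<psi>"
    using \<psi>(3) by (auto simp: time_slice_def)
  ultimately have "nontrivial \<psi>"
    unfolding nontrivial_def
    by (metis Pair_inject Zero_not_Suc domI)
  then show ?thesis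
    using \<psi>(1) \<open>\<psi> (0, 0) = Some \<xi>\<close> by (auto simp: solution_from_def)
qed

section \<open>Maximal solutions\<close>

lemma maximal_solution_slice_nonempty:
  assumes max: "maximal_solution H \<phi>"
  shows "time_slice \<phi> j \<noteq> {}"
proof (induction j)
  case 0
  have "(0, 0) \<in> dom \<phi>"
    using max hybrid_time_domain_origin
    by (simp add: maximal_solution_def hybrid_solution_def)
  then show ?case
    unfolding time_slice_def by blast
next
  case (Suc j)
  show ?case
  proof
    assume last: "time_slice \<phi> (Suc j) = {}"
    obtain t where "t \<in> time_slice \<phi> j"
      using Suc by blast
    moreover have "hybrid_solution H \<phi>"
      using max by (simp add: maximal_solution_def)
    ultimately obtain \<psi> where
      \<psi>: "hybrid_solution H \<psi>" "\<phi> \<subseteq>\<^sub>m \<psi>" "time_slice \<psi> (Suc j) \<noteq> {}"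
      using hybrid_solution_extend last by metis
    have "dom \<phi> \<subset> dom \<psi>"
      using map_le_implies_dom_le[OF \<psi>(2)] \<psi>(3) last unfolding time_slice_def by blast
    then show False
      using max \<psi>(1,2) unfolding maximal_solution_def by blast
  qed
qed

text \<open>Counting begins at slice 1: the initial timer may be below \<open>\<tau>min\<close>, so
  slice 0 guarantees no positive duration, whereas each later slice starts from a reset
  timer.\<close>

lemma maximal_solution_slice_start_ge:
  assumes max: "maximal_solution H \<phi>"
  shows "real j * \<tau>min \<le> slice_start \<phi> (Suc j)"
proof (induction j)
  case 0
  obtain t where "t \<in> time_slice \<phi> 1"
    using maximal_solution_slice_nonempty[OF max] by blast
  moreover have sol: "hybrid_solution H \<phi>"
    using max by (simp add: maximal_solution_def)
  moreover have htd: "hybrid_time_domain (dom \<phi>)"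
    using sol by (simp add: hybrid_solution_def)
  ultimately have "(slice_start \<phi> 1, 1) \<in> dom \<phi>"
    using slice_start_in[OF htd, of t 1] by (simp add: time_slice_def)
  then show ?case
    using htd unfolding hybrid_time_domain_def by auto
next
  case (Suc j)
  have sol: "hybrid_solution H \<phi>"
    using max by (simp add: maximal_solution_def)
  obtain s t where "s \<in> time_slice \<phi> (Suc j)" "t \<in> time_slice \<phi> (Suc (Suc j))"
    using maximal_solution_slice_nonempty[OF max] by blast
  then show ?case
    using slice_start_step[OF sol, of t "Suc j"] start_state_in_jump_map(1)[OF sol, of s j] Suc
    by (simp add: algebra_simps)
qed

text \<open>The slice starts form points of the domain with every index \<open>j\<close>, which
  gives completeness; their times grow at least linearly, which excludes Zeno behaviour.\<close>

lemma maximal_solution_complete_not_zeno: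
  assumes max: "maximal_solution H \<phi>"
  shows "complete_arc \<phi>" "\<not> zeno \<phi>"
proof -
  have htd: "hybrid_time_domain (dom \<phi>)"
    using max by (simp add: maximal_solution_def hybrid_solution_def)
  have dom: "(slice_start \<phi> j, j) \<in> dom \<phi>" for j
  proof -
    obtain t where "t \<in> time_slice \<phi> j"
      using maximal_solution_slice_nonempty[OF max] by blast
    then show ?thesis
      using slice_start_in[OF htd, of t j] by (simp add: time_slice_def)
  qed
  show "complete_arc \<phi>"
    unfolding complete_arc_def
  proof
    assume "bounded ((\<lambda>(t, j). (t, real j)) ` dom \<phi>)"
    then obtain B where B: "\<And>t j. (t, j) \<in> dom \<phi> \<Longrightarrow> norm (t, real j) \<le> B"
      unfolding bounded_iff by fast
    obtain j where "B < real j"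
      using reals_Archimedean2 by blast
    also have "real j \<le> norm (slice_start \<phi> j, real j)"
      using norm_snd_le[of "real j" "slice_start \<phi> j"] by simp
    finally show False
      using B[OF dom[of j]] by simp
  qed
  show "\<not> zeno \<phi>"
  proof
    assume "zeno \<phi>"
    then obtain B where B: "\<And>p. p \<in> dom \<phi> \<Longrightarrow> fst p \<le> B"
      unfolding zeno_def bdd_above_def by blast
    obtain j where "B < real j * \<tau>min"
      using reals_Archimedean3[OF \<tau>(1)] by blast
    then show False
      using B[OF dom[of "Suc j"]] maximal_solution_slice_start_ge[OF max, of j] by simp
  qed
qed

end

theorem lemma2:
  fixes L :: "real ^ 'n \<Rightarrow> real" and \<beta> K \<tau>min \<tau>max :: real
  assumes "twice_continuously_differentiable L"
    and "\<beta> > 0" and "strongly_convex \<beta> L"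
    and "K-lipschitz_on UNIV (gradient L)"
    and "0 < \<tau>min" and "\<tau>min \<le> \<tau>max" and "\<tau>max < \<beta>\<^sup>2 / (3 * K ^ 3)"
  defines "H \<equiv> sampled_gradient_system L \<tau>min \<tau>max"
  shows "(\<forall>\<xi>\<^sub>0 \<in> flow_set H \<union> jump_set H. \<exists>\<phi>. solution_from H \<xi>\<^sub>0 \<phi> \<and> nontrivial \<phi>) \<and>
         (\<forall>\<phi>. maximal_solution H \<phi> \<longrightarrow> complete_arc \<phi> \<and> \<not> zeno \<phi>)"
  unfolding H_def
  using nontrivial_solution_exists[OF assms(5,6)] maximal_solution_complete_not_zeno[OF assms(5,6)]
  by blast

end
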